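(* Let $n\ge2$ be an integer, let $n<p<\infty$ and let $q<0$ be defined by $\frac1q=\frac1p-\frac1n$. There exists a constant $\alpha_{n,p}>0$ depending only on $n$ and $p$ (in particular independent of $f$ and of its support) such that for every compactly supported $C^1$ function $f:\mathbb{R}^n\to\mathbb{R}$, $$\sup_{t>0}\Big\{\big(\Vert f\Vert_\infty-f^*(t)\big)\,t^{1/q}\Big\}\ \le\ \alpha_{n,p}\,\Vert f\Vert_{\infty,p}.$$
   Context: $|\cdot|_n$ is $n$-dimensional Lebesgue measure and $\Vert f\Vert_\infty$ is the $L_\infty(\mathbb{R}^n)$-norm. The decreasing rearrangement of $f$ is $f^*(t)=\inf\{\lambda>0 : |\{|f|>\lambda\}|_n\le t\}$, $t\ge 0$, and its Hardy transform is $f^{**}(t)=\frac1t\int_0^t f^*(s)\,ds$. For $1\le p<\infty$ set $$\Vert f\Vert_{\infty,p}=\left(\int_0^\infty \big(f^{**}(t)-f^*(t)\big)^p\,\frac{dt}{t^{p/n}}\right)^{1/p}.$$ *)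

theory Defs
  imports "HOL-Probability.Essential_Supremum"
begin

definition Linfty_norm :: "(real ^ 'n \<Rightarrow> real) \<Rightarrow> ereal"
  where "Linfty_norm f = esssup lebesgue (\<lambda>x. ereal \<bar>f x\<bar>)"

(* The real-valued infimum below is the usual one whenever the set is nonempty,
   i.e. whenever some level set {|f| > lam} has measure at most t. In particular this holds
   for every t >= 0 if f is bounded. *)
definition decr_rearr :: "(real ^ 'n \<Rightarrow> real) \<Rightarrow> real \<Rightarrow> real"
  where "decr_rearr f t =
    Inf {lam. lam > 0 \<and> emeasure lebesgue {x. \<bar>f x\<bar> > lam} \<le> ennreal t}"

(* For bounded f the integrand is bounded and nonincreasing, hence integrable on {0..t}. *)
definition hardy_rearr :: "(real ^ 'n \<Rightarrow> real) \<Rightarrow> real \<Rightarrow> real"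
  where "hardy_rearr f t = 1 / t * (LINT s:{0..t}|lebesgue. decr_rearr f s)"

(* The integral is taken with values in [0, infinity], so divergence gives the value infinity;
   the conditional extends the p-th root to [0, infinity]. *)
definition norm_infty_p :: "real \<Rightarrow> (real ^ 'n \<Rightarrow> real) \<Rightarrow> ennreal"
  where "norm_infty_p p f =
    (let I = (\<integral>\<^sup>+ t \<in> {0<..}.
                ennreal ((hardy_rearr f t - decr_rearr f t) powr p
                         / t powr (p / real CARD('n))) \<partial>lebesgue)
     in if I = \<infinity> then \<infinity> else ennreal (enn2real I powr (1 / p)))"

definition C1_fun :: "(real ^ 'n \<Rightarrow> real) \<Rightarrow> bool"
  where "C1_fun f \<longleftrightarrow>
    (\<exists>f' :: real ^ 'n \<Rightarrow> (real ^ 'n) \<Rightarrow>\<^sub>L real.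
       (\<forall>x. (f has_derivative blinfun_apply (f' x)) (at x)) \<and> continuous_on UNIV f')"

definition compactly_supported :: "(real ^ 'n \<Rightarrow> real) \<Rightarrow> bool"
  where "compactly_supported f \<longleftrightarrow> compact (closure (support_on UNIV f))"

end

theory Submission
  imports Defs
begin

text \<open>
  Write \<open>h = f\<^sup>*\<^sup>* - f\<^sup>*\<close>. Since \<open>f\<^sup>*\<close> is nonincreasing, \<open>t h(t)\<close> is nondecreasing, so the part over
  \<open>[t, 2t]\<close> of the integral defining \<open>\<parallel>f\<parallel>\<^sub>\<infinity>\<^sub>,\<^sub>p\<close> already gives \<open>h(t) \<le> C \<parallel>f\<parallel>\<^sub>\<infinity>\<^sub>,\<^sub>p t\<^sup>\<gamma>\<close> with
  \<open>\<gamma> = 1/n - 1/p = -1/q > 0\<close>. As \<open>f\<^sup>*(t/2) - f\<^sup>*(t) \<le> 2 h(t)\<close>, summing a geometric series over the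
  points \<open>t/2\<^sup>k\<close>, where \<open>f\<^sup>*\<close> tends to \<open>\<parallel>f\<parallel>\<^sub>\<infinity>\<close>, yields the claim; neither differentiation of
  \<open>f\<^sup>*\<^sup>*\<close> nor Hoelder's inequality is needed.
\<close>

section \<open>Integrals of bounded nonincreasing functions\<close>

lemma antimono_set_integrable_lebesgue:
  fixes g :: "real \<Rightarrow> real"
  assumes "antimono g" and bd: "\<And>x. \<bar>g x\<bar> \<le> M"
  shows "set_integrable lebesgue {a..b} g"
proof -
  have "mono (\<lambda>x. - g x)"
    using assms(1) by (auto simp: mono_def antimono_def)
  then have "(\<lambda>x. - g x) \<in> borel_measurable borel"
    by (rule borel_measurable_mono)
  then have "(\<lambda>x. - (- g x)) \<in> borel_measurable borel"
    by (rule borel_measurable_uminus)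
  then have "g \<in> borel_measurable lebesgue"
    by (simp add: measurable_completion)
  then show ?thesis
    unfolding set_integrable_def
    by (intro integrableI_bounded_set_indicator[where B=M]) (auto simp: bd emeasure_lborel_Icc_eq)
qed

text \<open>On \<open>{s<..t}\<close> the integrand is at least \<open>g t\<close>. This is applied
  below with general \<open>s\<close>, with \<open>s = 0\<close> and with
  \<open>s = t / 2\<close>.\<close>

lemma antimono_set_integral_diff_ge:
  fixes g :: "real \<Rightarrow> real"
  assumes anti: "antimono g" and bd: "\<And>x. \<bar>g x\<bar> \<le> M" and "0 \<le> s" "s \<le> t"
  shows "(t - s) * g t \<le> (LINT x:{0..t}|lebesgue. g x) - (LINT x:{0..s}|lebesgue. g x)"
proof -
  note int = antimono_set_integrable_lebesgue[OF anti bd]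
  have int': "set_integrable lebesgue {s<..t} g"
    using int[of s t] by (rule set_integrable_subset) auto
  have "{0..t} = {0..s} \<union> {s<..t}"
    using assms by auto
  then have "(LINT x:{0..t}|lebesgue. g x) =
      (LINT x:{0..s}|lebesgue. g x) + (LINT x:{s<..t}|lebesgue. g x)"
    using set_integral_Un[OF _ int[of 0 s] int'] by (simp add: disjoint_iff)
  moreover have "(LINT x:{s<..t}|lebesgue. g t) \<le> (LINT x:{s<..t}|lebesgue. g x)"
  proof (rule set_integral_mono[OF _ int'])
    show "set_integrable lebesgue {s<..t} (\<lambda>x. g t)"
      using \<open>s \<le> t\<close> by (simp add: set_integrable_def)
  qed (use anti in \<open>auto simp: antimono_def\<close>)
  moreover have "(LINT x:{s<..t}|lebesgue. g t) = (t - s) * g t"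
    using \<open>s \<le> t\<close> by (simp add: set_lebesgue_integral_def)
  ultimately show ?thesis
    by simp
qed

section \<open>Rearrangements of bounded measurable functions\<close>

context
  fixes f :: "real ^ 'n::finite \<Rightarrow> real" and M :: real
  assumes meas: "f \<in> borel_measurable lebesgue" and pos: "0 < M" and bound: "\<And>x. \<bar>f x\<bar> \<le> M"
begin

text \<open>The superlevel set at \<open>M\<close> is empty, so the infimum in
  \<open>decr_rearr\<close> runs over a nonempty set for every real \<open>t\<close>, even for
  negative \<open>t\<close>, where \<open>ennreal t = 0\<close>. Hence \<open>decr_rearr f\<close>
  is bounded and monotone on the whole line, as the integration lemmas require.\<close>

lemma decr_rearr_set_mem:
  "M \<in> {lam. lam > 0 \<and> emeasure lebesgue {x. \<bar>f x\<bar> > lam} \<le> ennreal t}"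
proof -
  have "{x. \<bar>f x\<bar> > M} = {}"
    using bound by (auto simp: not_less)
  then show ?thesis
    using pos by (simp del: not_less)
qed

lemma decr_rearr_nonneg: "0 \<le> decr_rearr f t"
  unfolding decr_rearr_def using decr_rearr_set_mem[of t] by (intro cInf_greatest) auto

lemma decr_rearr_le: "decr_rearr f t \<le> M"
  unfolding decr_rearr_def by (rule cInf_lower[OF decr_rearr_set_mem]) (auto intro: bdd_belowI[of _ 0])

lemma antimono_decr_rearr: "antimono (decr_rearr f)"
proof (rule antimonoI)
  fix s t :: real
  assume "s \<le> t"
  then show "decr_rearr f t \<le> decr_rearr f s"
    unfolding decr_rearr_def using decr_rearr_set_mem[of s]
    by (intro cInf_superset_mono)
      (auto intro!: bdd_belowI[of _ 0] intro: order_trans[OF _ ennreal_leI])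
qed

text \<open>From \<open>s\<close> to \<open>t\<close> the integral of \<open>decr_rearr f\<close>
  grows by at least \<open>(t - s) * decr_rearr f t\<close>, so the right side exceeds the left by
  at least \<open>s * (decr_rearr f s - decr_rearr f t)\<close>, which is nonnegative.\<close>

lemma hardy_rearr_diff_mono:
  assumes "0 < s" "s \<le> t"
  shows "s * (hardy_rearr f s - decr_rearr f s) \<le> t * (hardy_rearr f t - decr_rearr f t)"
proof -
  have "(t - s) * decr_rearr f t \<le> (LINT x:{0..t}|lebesgue. decr_rearr f x)
      - (LINT x:{0..s}|lebesgue. decr_rearr f x)"
    using assms decr_rearr_nonneg decr_rearr_le
    by (intro antimono_set_integral_diff_ge[where M=M] antimono_decr_rearr) auto
  moreover have "s * decr_rearr f t \<le> s * decr_rearr f s"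
    using assms antimono_decr_rearr by (intro mult_left_mono) (auto simp: antimono_def)
  moreover have "u * (hardy_rearr f u - decr_rearr f u) =
      (LINT x:{0..u}|lebesgue. decr_rearr f x) - u * decr_rearr f u" if "0 < u" for u
    using that by (simp add: hardy_rearr_def right_diff_distrib)
  from this[of s] this[of t]
  have "s * (hardy_rearr f s - decr_rearr f s) =
      (LINT x:{0..s}|lebesgue. decr_rearr f x) - s * decr_rearr f s"
    "t * (hardy_rearr f t - decr_rearr f t) =
      (LINT x:{0..t}|lebesgue. decr_rearr f x) - t * decr_rearr f t"
    using assms by auto
  ultimately show ?thesis
    unfolding left_diff_distrib by linarith
qed

text \<open>A nonincreasing function is on average at least its last value. Later this keeps the
  bases of \<open>powr p\<close> nonnegative, where \<open>powr\<close> is monotone.\<close>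

lemma decr_rearr_le_hardy_rearr:
  assumes "0 < t"
  shows "decr_rearr f t \<le> hardy_rearr f t"
proof -
  have "(t - 0) * decr_rearr f t \<le> (LINT x:{0..t}|lebesgue. decr_rearr f x)
      - (LINT x:{0..0}|lebesgue. decr_rearr f x)"
    using assms decr_rearr_nonneg decr_rearr_le
    by (intro antimono_set_integral_diff_ge[where M=M] antimono_decr_rearr) auto
  moreover have "(LINT x:{0::real..0}|lebesgue. decr_rearr f x) = 0"
    unfolding set_lebesgue_integral_def
    using AE_completion[OF AE_lborel_singleton[of "0::real"]]
    by (intro integral_eq_zero_AE) (auto elim: eventually_mono)
  ultimately show ?thesis
    using assms by (simp add: hardy_rearr_def field_simps)
qed

text \<open>Split the integral over \<open>{0..t}\<close> at \<open>t / 2\<close>: the halves are at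
  least \<open>t / 2 * decr_rearr f (t / 2)\<close> and \<open>t / 2 * decr_rearr f t\<close>. So
  \<open>hardy_rearr f t\<close> dominates the mean of these two values of
  \<open>decr_rearr f\<close>.\<close>

lemma decr_rearr_half_diff_le:
  assumes "0 < t"
  shows "decr_rearr f (t / 2) - decr_rearr f t \<le> 2 * (hardy_rearr f t - decr_rearr f t)"
proof -
  have "(t - t / 2) * decr_rearr f t \<le> (LINT x:{0..t}|lebesgue. decr_rearr f x)
      - (LINT x:{0..t / 2}|lebesgue. decr_rearr f x)"
    using assms decr_rearr_nonneg decr_rearr_le
    by (intro antimono_set_integral_diff_ge[where M=M] antimono_decr_rearr) auto
  moreover have "decr_rearr f (t / 2) \<le> hardy_rearr f (t / 2)"
    using assms by (intro decr_rearr_le_hardy_rearr) auto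
  ultimately show ?thesis
    using assms by (simp add: hardy_rearr_def field_simps)
qed

section \<open>Pointwise bound by the norm and dyadic summation\<close>

text \<open>Since \<open>s * h s\<close> is nondecreasing, \<open>h\<close> stays above
  \<open>h t / 2\<close> on \<open>{t..2 * t}\<close>, and this interval of length \<open>t\<close>
  alone bounds the integral from below.\<close>

lemma hardy_rearr_diff_le_norm_infty_p:
  assumes p: "0 < p" and t: "0 < t" and fin: "norm_infty_p p f \<noteq> \<infinity>"
  shows "hardy_rearr f t - decr_rearr f t \<le>
    2 * 2 powr (1 / real CARD('n)) * enn2real (norm_infty_p p f)
      * t powr (1 / real CARD('n) - 1 / p)"
proof -
  define n where "n = real CARD('n)"
  have n: "0 < n"
    by (simp add: n_def)
  define h where "h s = hardy_rearr f s - decr_rearr f s" for s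
  define F where "F s = ennreal (h s powr p / s powr (p / n))" for s
  define I where "I = (\<integral>\<^sup>+ s \<in> {0<..}. F s \<partial>lebesgue)"
  \<comment> \<open>A lower bound for the integrand on \<open>{t..2 * t}\<close>: \<open>h s\<close>
    is at least \<open>h t / 2\<close>, and the denominator is largest at \<open>2 * t\<close>. The
    two factors 2 become the constant \<open>2 * 2 powr (1 / n)\<close>.\<close>
  define L where "L = (h t / 2) powr p / (2 * t) powr (p / n)"
  have norm: "norm_infty_p p f = (if I = \<infinity> then \<infinity> else ennreal (enn2real I powr (1 / p)))"
    unfolding norm_infty_p_def I_def F_def h_def n_def Let_def ..
  \<comment> \<open>Needed because \<open>enn2real\<close> sends infinity to 0, so only a finite
    \<open>I\<close> keeps its lower bound when read as a real number.\<close>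
  have I: "I \<noteq> \<infinity>"
    using fin norm by auto
  have ht: "0 \<le> h t"
    using decr_rearr_le_hardy_rearr[OF t] by (simp add: h_def)
  have F: "ennreal L \<le> F s" if s: "s \<in> {t..2 * t}" for s
  proof -
    have "t * h t \<le> s * h s"
      using hardy_rearr_diff_mono[of t s] s t by (simp add: h_def)
    also have "s * h s \<le> 2 * t * h s"
      using s t decr_rearr_le_hardy_rearr[of s] by (intro mult_right_mono) (auto simp: h_def)
    finally have "h t / 2 \<le> h s"
      using t by simp
    then have "L \<le> h s powr p / s powr (p / n)"
      unfolding L_def using s t p n ht
      by (intro frac_le powr_mono2) auto
    then show ?thesis
      unfolding F_def by (rule ennreal_leI)
  qed
  have "ennreal (L * t) = ennreal L * ennreal t"
    using t by (intro ennreal_mult) (auto simp: L_def)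
  also have "\<dots> = (\<integral>\<^sup>+ s. ennreal L * indicator {t..2 * t} s \<partial>lebesgue)"
    using t by (simp add: nn_integral_cmult_indicator)
  also have "\<dots> \<le> I"
    unfolding I_def using F t by (intro nn_integral_mono) (auto split: split_indicator)
  finally have "enn2real (ennreal (L * t)) \<le> enn2real I"
    using I by (intro enn2real_mono) (auto simp: less_top)
  then have "L * t \<le> enn2real I"
    using t by (simp add: L_def)
  then have "(L * t) powr (1 / p) \<le> enn2real I powr (1 / p)"
    using p t by (intro powr_mono2) (auto simp: L_def)
  also have "(L * t) powr (1 / p) = h t / 2 / (2 * t) powr (1 / n) * t powr (1 / p)"
    using p t ht by (simp add: L_def powr_mult powr_divide powr_powr)
  also have "enn2real I powr (1 / p) = enn2real (norm_infty_p p f)"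
    using I by (simp add: norm)
  finally have "h t \<le> enn2real (norm_infty_p p f) * (2 * (2 * t) powr (1 / n)) / t powr (1 / p)"
    using t by (simp add: field_simps)
  then show ?thesis
    using t by (simp add: h_def n_def powr_mult powr_diff mult_ac)
qed

text \<open>The constant is the geometric sum of \<open>D * r ^ j\<close> with
  \<open>r = 2 powr (- c)\<close>, where \<open>r < 1\<close> because \<open>c > 0\<close>.\<close>

lemma decr_rearr_dyadic_diff_le:
  fixes c D :: real
  assumes half: "\<And>t. 0 < t \<Longrightarrow> decr_rearr f (t / 2) - decr_rearr f t \<le> D * t powr c"
    and c: "0 < c" and t: "0 < t"
  shows "decr_rearr f (t / 2 ^ k) - decr_rearr f t \<le> D / (1 - 2 powr (- c)) * t powr c"
proof -
  define r where "r = 2 powr (- c)"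
  have r: "r < 1" "0 < r"
    using c by (auto simp: r_def powr_less_one)
  \<comment> \<open>The sign of \<open>D\<close>, needed for \<open>k = 0\<close>, follows from
    \<open>half\<close> at \<open>t = 1\<close> and monotonicity.\<close>
  have D: "0 \<le> D"
  proof -
    have "0 \<le> decr_rearr f (1 / 2) - decr_rearr f 1"
      using antimono_decr_rearr by (simp add: antimono_def)
    also have "\<dots> \<le> D"
      using half[of 1] by simp
    finally show ?thesis .
  qed
  show ?thesis
    unfolding r_def[symmetric] using t
  proof (induction k arbitrary: t)
    case 0
    then show ?case
      using D r by simp
  next
    case (Suc k)
    \<comment> \<open>The step from \<open>t\<close> to \<open>t / 2\<close> is split off and the
      induction hypothesis is used at \<open>t / 2\<close>. The constant
      \<open>K = D / (1 - r)\<close> reproduces itself, as \<open>K * r + D = K\<close>.\<close>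
    have "decr_rearr f (t / 2 / 2 ^ k) - decr_rearr f (t / 2) \<le> D / (1 - r) * (t / 2) powr c"
      by (rule Suc.IH) (use Suc.prems in simp)
    also have "(t / 2) powr c = r * t powr c"
      using Suc.prems by (simp add: r_def powr_divide powr_minus_divide)
    finally have "decr_rearr f (t / 2 ^ Suc k) - decr_rearr f t
        \<le> D / (1 - r) * (r * t powr c) + D * t powr c"
      using half[OF Suc.prems] by (simp add: mult.assoc)
    also have "\<dots> = D / (1 - r) * t powr c"
      using r by (simp add: field_simps)
    finally show ?case .
  qed
qed

section \<open>The essential supremum and the rearrangement near zero\<close>

lemma superlevel_set_lebesgue: "{x. \<bar>f x\<bar> > lam} \<in> sets lebesgue"
proof -
  have "{x \<in> space lebesgue. lam < \<bar>f x\<bar>} \<in> sets lebesgue"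
    using meas by (intro borel_measurable_less) auto
  then show ?thesis
    by simp
qed

text \<open>If \<open>\<bar>f x\<bar> > B + e\<close> on a set of positive measure, then for
  \<open>s\<close> below that measure no level under \<open>B + e\<close> is admissible in the
  infimum, which forces \<open>decr_rearr f s \<ge> B + e\<close>.\<close>

lemma Linfty_norm_le_decr_rearr_bound:
  assumes "\<And>\<delta>. 0 < \<delta> \<Longrightarrow> \<exists>s. 0 < s \<and> s \<le> \<delta> \<and> decr_rearr f s \<le> B"
  shows "Linfty_norm f \<le> ereal B"
proof (rule ereal_le_epsilon2)
  fix e :: real
  assume e: "0 < e"
  define S where "S = {x. \<bar>f x\<bar> > B + e}"
  have S: "S \<in> sets lebesgue"
    unfolding S_def by (rule superlevel_set_lebesgue)
  have "emeasure lebesgue S = 0"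
  proof (rule ccontr)
    assume "emeasure lebesgue S \<noteq> 0"
    then have "0 < emeasure lebesgue S"
      by (simp add: zero_less_iff_neq_zero)
    \<comment> \<open>An intermediate value is finite even if \<open>S\<close> has infinite measure,
      so it yields a real \<open>\<delta>\<close>.\<close>
    then obtain d where d: "0 < d" "d < emeasure lebesgue S"
      using dense by blast
    then have "d < top"
      using top.not_eq_extremum by fastforce
    with d obtain \<delta> where \<delta>: "0 < \<delta>" "ennreal \<delta> < emeasure lebesgue S"
      by (cases d) auto
    obtain s where s: "0 < s" "s \<le> \<delta>" "decr_rearr f s \<le> B"
      using assms[OF \<delta>(1)] by blast
    have "B + e \<le> decr_rearr f s"
      unfolding decr_rearr_def
    proof (rule cInf_greatest)
      show "{lam. lam > 0 \<and> emeasure lebesgue {x. \<bar>f x\<bar> > lam} \<le> ennreal s} \<noteq> {}"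
        using decr_rearr_set_mem[of s] by blast
      fix lam
      assume "lam \<in> {lam. lam > 0 \<and> emeasure lebesgue {x. \<bar>f x\<bar> > lam} \<le> ennreal s}"
      then have lam: "emeasure lebesgue {x. \<bar>f x\<bar> > lam} \<le> ennreal s"
        by simp
      show "B + e \<le> lam"
      proof (rule ccontr)
        assume "\<not> B + e \<le> lam"
        then have "emeasure lebesgue S \<le> emeasure lebesgue {x. \<bar>f x\<bar> > lam}"
          by (intro emeasure_mono superlevel_set_lebesgue) (auto simp: S_def)
        also have "\<dots> \<le> ennreal \<delta>"
          using lam s by (meson ennreal_leI order_trans)
        finally show False
          using \<delta>(2) by simp
      qed
    qed
    then show False
      using s(3) e by simp
  qed
  then have "AE x in lebesgue. \<bar>f x\<bar> \<le> B + e"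
    using S by (intro AE_I[of _ _ S]) (auto simp: S_def)
  then show "Linfty_norm f \<le> ereal B + ereal e"
    unfolding Linfty_norm_def using meas by (intro esssup_I) auto
qed

lemma Linfty_norm_diff_decr_rearr_le:
  assumes p: "real CARD('n) < p" and c: "c = 1 / real CARD('n) - 1 / p"
    and t: "0 < t" and fin: "norm_infty_p p f \<noteq> \<infinity>"
  shows "Linfty_norm f - ereal (decr_rearr f t)
    \<le> ereal (4 * 2 powr (1 / real CARD('n)) / (1 - 2 powr (- c))
        * enn2real (norm_infty_p p f) * t powr c)"
proof -
  \<comment> \<open>The factor 4 combines the 2 of the halving estimate with the 2 of the pointwise
    bound.\<close>
  define D where "D = 4 * 2 powr (1 / real CARD('n)) * enn2real (norm_infty_p p f)"
  define B where "B = decr_rearr f t + D / (1 - 2 powr (- c)) * t powr c"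
  have n: "0 < real CARD('n)"
    by simp
  have c0: "0 < c"
    using p n unfolding c by (simp add: field_simps)
  have half: "decr_rearr f (s / 2) - decr_rearr f s \<le> D * s powr c" if "0 < s" for s
    using decr_rearr_half_diff_le[OF that] hardy_rearr_diff_le_norm_infty_p[OF _ that fin] p
    by (simp add: c D_def)
  have "Linfty_norm f \<le> ereal B"
  proof (rule Linfty_norm_le_decr_rearr_bound)
    fix \<delta> :: real
    assume "0 < \<delta>"
    obtain k where "t / \<delta> < 2 ^ k"
      using real_arch_pow[of 2 "t / \<delta>"] by auto
    then have "t / 2 ^ k \<le> \<delta>"
      using \<open>0 < \<delta>\<close> by (simp add: field_simps)
    moreover have "decr_rearr f (t / 2 ^ k) \<le> B"
      using decr_rearr_dyadic_diff_le[OF half c0 t, of k] by (simp add: B_def)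
    ultimately show "\<exists>s. 0 < s \<and> s \<le> \<delta> \<and> decr_rearr f s \<le> B"
      using t by (intro exI[of _ "t / 2 ^ k"]) auto
  qed
  then have "Linfty_norm f - ereal (decr_rearr f t) \<le> ereal B - ereal (decr_rearr f t)"
    by (intro ereal_minus_mono) auto
  then show ?thesis
    by (simp add: B_def D_def)
qed

end

section \<open>Compactly supported continuously differentiable functions\<close>

lemma C1_fun_continuous:
  assumes "C1_fun f"
  shows "continuous_on UNIV f"
  using assms unfolding C1_fun_def
  by (metis continuous_at_imp_continuous_on has_derivative_continuous)

lemma compactly_supported_bounded:
  assumes "continuous_on UNIV f" "compactly_supported f"
  obtains M where "0 < M" "\<And>x. \<bar>f x\<bar> \<le> M"
proof -
  let ?K = "closure (support_on UNIV f)"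
  have "compact (f ` ?K)"
    using assms by (intro compact_continuous_image)
      (auto simp: compactly_supported_def intro: continuous_on_subset)
  then obtain M where M: "0 < M" "\<And>y. y \<in> f ` ?K \<Longrightarrow> norm y \<le> M"
    using bounded_pos compact_imp_bounded by metis
  have "\<bar>f x\<bar> \<le> M" for x
  proof (cases "f x = 0")
    case False
    then have "x \<in> ?K"
      using closure_subset[of "support_on UNIV f"] by (auto simp: support_on_def)
    then show ?thesis
      using M(2)[of "f x"] by auto
  qed (use M in auto)
  then show thesis
    using M that by blast
qed

theorem proposition2p1:
  fixes p q :: real
  assumes "CARD('n::finite) \<ge> 2"
    and "real CARD('n) < p"
    and "q < 0"
    and "1 / q = 1 / p - 1 / real CARD('n)"
  shows "\<exists>\<alpha>::real. \<alpha> > 0 \<and>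
    (\<forall>f :: real ^ 'n \<Rightarrow> real. C1_fun f \<and> compactly_supported f \<longrightarrow>
      (SUP t\<in>{0::real<..}. (Linfty_norm f - ereal (decr_rearr f t)) * ereal (t powr (1 / q)))
        \<le> ereal \<alpha> * enn2ereal (norm_infty_p p f))"
proof -
  \<comment> \<open>This is \<open>- 1 / q\<close>, so the weight \<open>t powr (1 / q)\<close>
    cancels the growth \<open>t powr c\<close> of the bound.\<close>
  define c where "c = 1 / real CARD('n) - 1 / p"
  define \<alpha> where "\<alpha> = 4 * 2 powr (1 / real CARD('n)) / (1 - 2 powr (- c))"
  have q: "1 / q = - c"
    using assms(4) by (simp add: c_def)
  have "0 < c"
    using q assms(3) by (metis neg_less_0_iff_less divide_less_0_1_iff)
  then have \<alpha>: "0 < \<alpha>"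
    by (simp add: \<alpha>_def powr_less_one)
  have "(Linfty_norm f - ereal (decr_rearr f t)) * ereal (t powr (1 / q))
      \<le> ereal \<alpha> * enn2ereal (norm_infty_p p f)"
    if f: "C1_fun f" "compactly_supported f" and t: "0 < t" for f :: "real ^ 'n \<Rightarrow> real" and t
  proof (cases "norm_infty_p p f = \<infinity>")
    \<comment> \<open>The right-hand side is infinite here because \<open>\<alpha> > 0\<close>. Only
      in the other case does \<open>enn2real\<close> represent the norm.\<close>
    case True
    then show ?thesis
      using \<alpha> by simp
  next
    case False
    obtain M where M: "0 < M" "\<And>x. \<bar>f x\<bar> \<le> M"
      using compactly_supported_bounded C1_fun_continuous f by blast
    have meas: "f \<in> borel_measurable lebesgue"
      using borel_measurable_continuous_onI[OF C1_fun_continuous[OF f(1)]]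
      by (intro measurable_completion) simp
    have "(Linfty_norm f - ereal (decr_rearr f t)) * ereal (t powr (1 / q))
        \<le> ereal (\<alpha> * enn2real (norm_infty_p p f) * t powr c) * ereal (t powr (- c))"
      unfolding \<alpha>_def q using assms(2) t False
      by (intro ereal_mult_right_mono Linfty_norm_diff_decr_rearr_le[OF meas M _ c_def]) auto
    also have "\<dots> = ereal \<alpha> * ereal (enn2real (norm_infty_p p f))"
      using t by (simp add: powr_minus)
    also have "ereal (enn2real (norm_infty_p p f)) = enn2ereal (norm_infty_p p f)"
      using False by (cases "norm_infty_p p f") auto
    finally show ?thesis .
  qed
  then show ?thesis
    using \<alpha> by (intro exI[of _ \<alpha>]) (auto intro!: SUP_least)
qed

end
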